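(* Let $m\ge 3$ be odd. Then the digraph ${\cal R}^{*}_{m}$ has exactly $$|V({\cal R}^{*}_{m})| = \binom{m+1}{(m-1)/2}$$ vertices, and the digraph ${\cal R}^{**}_{m}$ has exactly $$|V({\cal R}^{**}_{m})| = \frac{1}{2}\left[\binom{m+1}{(m-1)/2} + \binom{(m+1)/2}{\lfloor (m+1)/4\rfloor}\right]$$ vertices.
   Context: Consider the grid graph $P_m\times P_n$ with vertices arranged in $m$ rows (numbered top to bottom) and $n$ columns. In a 2-factor (spanning union of cycles) every vertex has exactly two incident edges among the directions up, down, left, right; these six possibilities are coded by letters: $a=\{\text{right},\text{down}\}$, $b=\{\text{up},\text{down}\}$, $c=\{\text{right},\text{up}\}$, $d=\{\text{left},\text{down}\}$, $e=\{\text{left},\text{right}\}$, $f=\{\text{left},\text{up}\}$. An alpha-word of length $m$ is a word $\alpha_1\alpha_2\cdots\alpha_m$ over $\{a,b,c,d,e,f\}$ such that $\alpha_1\in\{a,d,e\}$, $\alpha_m\in\{c,e,f\}$, and for each $1\le i\le m-1$, $\alpha_i$ contains "down" if and only if $\alpha_{i+1}$ contains "up". The digraph ${\cal D}_m$ has the alpha-words of length $m$ as vertices, with an arc $v\to u$ iff for every $i$, $v_i$ contains "right" if and only if $u_i$ contains "left". The outlet word of an alpha-word $\alpha$ is the binary word $o(\alpha)=o_1\cdots o_m$ with $o_j=1$ if $\alpha_j\in\{a,c,e\}$ and $o_j=0$ if $\alpha_j\in\{b,d,f\}$. The digraph ${\cal D}^*_m$ has as vertices all binary words $o(\alpha)$,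 $\alpha\in V({\cal D}_m)$, with an arc $x\to y$ iff there exist $v,u\in V({\cal D}_m)$ with $o(v)=x$, $o(u)=y$ and $v\to u$ an arc of ${\cal D}_m$ (no multiple arcs). ${\cal R}^*_m$ denotes the connected component of ${\cal D}^*_m$ containing the word $0^m$. For a binary word $x=b_1\cdots b_m$ let $\overline{x}=b_m\cdots b_1$ be its reversal (it is known that $x\in V({\cal R}^*_m)$ implies $\overline{x}\in V({\cal R}^*_m)$). The digraph ${\cal R}^{**}_m$ is obtained from ${\cal R}^*_m$ by identifying each vertex $x$ with $\overline{x}$; thus its vertices are the sets $\{x,\overline{x}\}$ with $x\in V({\cal R}^*_m)$. *)

theory Defs
  imports Complex_Main "Graph_Theory.Graph_Theory"
begin

datatype direction = Up | Down | Left | Right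

datatype letter = La | Lb | Lc | Ld | Le | Lf

fun directions :: "letter \<Rightarrow> direction set" where
  "directions La = {Right, Down}"
| "directions Lb = {Up, Down}"
| "directions Lc = {Right, Up}"
| "directions Ld = {Left, Down}"
| "directions Le = {Left, Right}"
| "directions Lf = {Left, Up}"

text \<open>
  Words are lists, so the i-th letter of a word (i = 1, ..., m) is the list entry at
  index i - 1.
\<close>

definition alpha_words :: "nat \<Rightarrow> letter list set" where
  "alpha_words m = {w. length w = m \<and> 0 < m \<and>
     w ! 0 \<in> {La, Ld, Le} \<and> w ! (m - 1) \<in> {Lc, Le, Lf} \<and>
     (\<forall>i. i + 1 < m \<longrightarrow>
        (Down \<in> directions (w ! i) \<longleftrightarrow> Up \<in> directions (w ! (i + 1))))}"

definition D_graph :: "nat \<Rightarrow> letter list pair_pre_digraph" where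
  "D_graph m = \<lparr> pverts = alpha_words m,
     parcs = {(v, u). v \<in> alpha_words m \<and> u \<in> alpha_words m \<and>
       (\<forall>i<m. Right \<in> directions (v ! i) \<longleftrightarrow> Left \<in> directions (u ! i))} \<rparr>"

text \<open>Binary words are lists of Booleans, with True for the digit 1 and False for 0.\<close>

definition outlet :: "letter list \<Rightarrow> bool list" where
  "outlet w = map (\<lambda>l. l \<in> {La, Lc, Le}) w"

definition D_star :: "nat \<Rightarrow> bool list pair_pre_digraph" where
  "D_star m = \<lparr> pverts = outlet ` pverts (D_graph m),
     parcs = {(x, y). \<exists>v \<in> pverts (D_graph m). \<exists>u \<in> pverts (D_graph m).
       outlet v = x \<and> outlet u = y \<and> (v, u) \<in> parcs (D_graph m)} \<rparr>"

text \<open>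
  The connected component of a vertex is the subdigraph induced on the vertices that can be
  reached from it when the orientation of the arcs is ignored.
\<close>

definition component_of :: "'a pair_pre_digraph \<Rightarrow> 'a \<Rightarrow> 'a pair_pre_digraph" where
  "component_of G r =
     (let C = {x. r \<rightarrow>\<^sup>*\<^bsub>with_proj (mk_symmetric (with_proj G))\<^esub> x}
      in \<lparr> pverts = C, parcs = {(x, y) \<in> parcs G. x \<in> C \<and> y \<in> C} \<rparr>)"

definition R_star :: "nat \<Rightarrow> bool list pair_pre_digraph" where
  "R_star m = component_of (D_star m) (replicate m False)"

text \<open>
  Identification of vertices moves the two ends of every arc to their classes and keeps all
  arcs; arcs that become parallel are not merged.
\<close>

definition rev_class :: "'a list \<Rightarrow> 'a list set" where
  "rev_class x = {x, rev x}"

definition R_star_star :: "nat \<Rightarrow> (bool list set, bool list \<times> bool list) pre_digraph" where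
  "R_star_star m = \<lparr> verts = rev_class ` pverts (R_star m), arcs = parcs (R_star m),
     tail = (\<lambda>e. rev_class (fst e)), head = (\<lambda>e. rev_class (snd e)) \<rparr>"

end

theory Submission
  imports Defs
begin

text \<open>
  Let \<open>m = 2 k + 1\<close>. Compare a binary word with the alternating word \<open>1010...1\<close> and record the set
  of positions of agreement. Following the vertical edges through one column shows that the
  agreement sets of two adjacent words have sizes adding up to \<open>m + 1\<close>, so on the component of
  \<open>0\<^sup>m\<close> these sizes are \<open>k\<close> or \<open>k + 2\<close>. Conversely, flipping all digits of a word but one at a
  position of agreement gives an adjacent word; two such steps exchange one element of the agreement
  set, which makes all words with these sizes reachable. Pascal's rule gives the first count.
  Since \<open>m\<close> is odd, reversal preserves the size of the agreement set, and a palindrome of the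
  component is determined by its first half, whose agreement set has size \<open>k div 2\<close> or
  \<open>k div 2 + 1\<close>.
\<close>

section \<open>Coding binary words by their agreement sets\<close>

definition agreement :: "bool list \<Rightarrow> nat set" where
  "agreement x = {i. i < length x \<and> x ! i = even i}"

definition word_of :: "nat \<Rightarrow> nat set \<Rightarrow> bool list" where
  "word_of m S = map (\<lambda>i. i \<in> S \<longleftrightarrow> even i) [0..<m]"

lemma finite_agreement [simp]: "finite (agreement x)"
  by (simp add: agreement_def)

lemma agreement_subset: "agreement x \<subseteq> {..<length x}"
  by (auto simp: agreement_def)

lemma length_word_of [simp]: "length (word_of m S) = m"
  by (simp add: word_of_def)

lemma nth_word_of [simp]: "i < m \<Longrightarrow> word_of m S ! i = (i \<in> S \<longleftrightarrow> even i)"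
  by (simp add: word_of_def)

lemma agreement_word_of [simp]: "S \<subseteq> {..<m} \<Longrightarrow> agreement (word_of m S) = S"
  by (auto simp: agreement_def)

lemma word_of_agreement [simp]: "length x = m \<Longrightarrow> word_of m (agreement x) = x"
  by (auto simp: agreement_def intro!: nth_equalityI)

lemma card_agreement:
  "card (agreement x) = (\<Sum>i<length x. of_bool (x ! i = even i))"
proof -
  have "agreement x = {..<length x} \<inter> {i. x ! i = even i}"
    by (auto simp: agreement_def)
  then show ?thesis
    by (simp add: sum_of_bool_eq)
qed

text \<open>Keeping \<open>P\<close> arbitrary lets one bijection serve both the finiteness and the
  counting results.\<close>

lemma bij_betw_agreement:
  "bij_betw agreement {x. length x = n \<and> P (card (agreement x))} {S. S \<subseteq> {..<n} \<and> P (card S)}"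
proof (rule bij_betwI[where g = "word_of n"])
  show "agreement \<in> {x. length x = n \<and> P (card (agreement x))} \<rightarrow> {S. S \<subseteq> {..<n} \<and> P (card S)}"
    using agreement_subset by fastforce
qed auto

lemma finite_words_agreement: "finite {x. length x = n \<and> P (card (agreement x))}"
  by (simp add: bij_betw_finite[OF bij_betw_agreement])

lemma card_words_agreement: "card {x. length x = n \<and> card (agreement x) = j} = n choose j"
  using bij_betw_same_card[OF bij_betw_agreement[of n "\<lambda>c. c = j"]] n_subsets[of "{..<n}" j]
  by simp

lemma card_words_agreement2:
  assumes "i \<noteq> j"
  shows "card {x. length x = n \<and> card (agreement x) \<in> {i, j}} = (n choose i) + (n choose j)"
proof -
  have "{x. length x = n \<and> card (agreement x) \<in> {i, j}} =
      {x. length x = n \<and> card (agreement x) = i} \<union> {x. length x = n \<and> card (agreement x) = j}"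
    by auto
  moreover have "{x. length x = n \<and> card (agreement x) = i} \<inter>
      {x. length x = n \<and> card (agreement x) = j} = {}"
    using assms by auto
  ultimately show ?thesis
    using finite_words_agreement[of n "\<lambda>c. c = i"] finite_words_agreement[of n "\<lambda>c. c = j"]
    by (simp add: card_Un_disjoint card_words_agreement)
qed

subsection \<open>Arcs and agreement sets\<close>

lemma outlet_eq: "outlet w = map (\<lambda>l. Right \<in> directions l) w"
proof -
  have "l \<in> {La, Lc, Le} \<longleftrightarrow> Right \<in> directions l" for l
    by (cases l) auto
  then show ?thesis
    by (simp add: outlet_def)
qed

text \<open>
  A position holding exactly one of the ends left and right adds 1 to the sum below; one holding
  both or neither adds 0 or 2 according to its parity, so the excess depends only on the vertical
  edge that leaves the prefix.
\<close>

lemma alpha_word_prefix: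
  assumes "w \<in> alpha_words m" and "n < m"
  defines "a \<equiv> \<lambda>i. of_bool ((Left \<in> directions (w ! i)) = even i) +
    of_bool ((Right \<in> directions (w ! i)) = even i) :: nat"
  shows "(\<Sum>i\<le>n. a i) + (if even n then of_bool (Down \<in> directions (w ! n)) else 0) =
    n + (if even n then 2 else 1 + of_bool (Down \<in> directions (w ! n)))"
  using \<open>n < m\<close>
proof (induction n)
  case 0
  then show ?case
    using assms(1) by (auto simp: alpha_words_def a_def)
next
  case (Suc n)
  have "Down \<in> directions (w ! n) \<longleftrightarrow> Up \<in> directions (w ! Suc n)"
    using assms(1) Suc.prems by (auto simp: alpha_words_def)
  with Suc show ?case
    by (cases "w ! Suc n") (auto simp: a_def split: if_splits)
qed

text \<open>For an arc from \<open>v\<close> to \<open>u\<close>, the digits of \<open>x\<close> are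
  the left ends of \<open>u\<close> and those of \<open>y\<close> its right ends. Both agreement
  sets can thus be read off the single column \<open>u\<close>.\<close>

lemma arc_card_agreement:
  assumes "odd m" and "(x, y) \<in> parcs (D_star m)"
  shows "length x = m" "length y = m" "card (agreement x) + card (agreement y) = m + 1"
proof -
  obtain v u where v: "v \<in> alpha_words m" and u: "u \<in> alpha_words m"
    and xy: "outlet v = x" "outlet u = y"
    and vu: "\<And>i. i < m \<Longrightarrow> Right \<in> directions (v ! i) \<longleftrightarrow> Left \<in> directions (u ! i)"
    using assms(2) by (auto simp: D_star_def D_graph_def)
  have len: "length v = m" "length u = m" "m > 0"
    using u v by (auto simp: alpha_words_def)
  show lx: "length x = m" and ly: "length y = m"
    using xy len by (auto simp: outlet_eq)
  have "card (agreement x) + card (agreement y) =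
      (\<Sum>i<m. of_bool (x ! i = even i) + of_bool (y ! i = even i))"
    by (simp add: card_agreement lx ly sum.distrib)
  also have "\<dots> = (\<Sum>i\<le>m - 1. of_bool ((Left \<in> directions (u ! i)) = even i) +
      of_bool ((Right \<in> directions (u ! i)) = even i))"
  proof (rule sum.cong)
    show "{..<m} = {..m - 1}"
      using \<open>m > 0\<close> by auto
    fix i assume "i \<in> {..m - 1}"
    then show "of_bool (x ! i = even i) + of_bool (y ! i = even i) =
        (of_bool ((Left \<in> directions (u ! i)) = even i) +
         of_bool ((Right \<in> directions (u ! i)) = even i) :: nat)"
      using len vu[of i] by (auto simp: outlet_eq simp flip: xy)
  qed
  also have "\<dots> = m + 1"
  proof -
    \<comment> \<open>The last index m - 1 is even and no edge leaves below it, so the prefix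
      formula gives (m - 1) + 2.\<close>
    have "Down \<notin> directions (u ! (m - 1))"
      using u by (auto simp: alpha_words_def)
    then show ?thesis
      using alpha_word_prefix[OF u, of "m - 1"] \<open>odd m\<close> \<open>m > 0\<close> by simp
  qed
  finally show "card (agreement x) + card (agreement y) = m + 1" .
qed

text \<open>
  The column with right ends \<open>y\<close> whose left ends are complementary to \<open>y\<close> except at \<open>j\<close>, where they
  coincide: a vertical edge leaves position \<open>i\<close> downwards iff \<open>i < j\<close> and \<open>i\<close> is even, or \<open>i > j\<close>
  and \<open>i\<close> is odd.
\<close>

definition column :: "nat \<Rightarrow> bool list \<Rightarrow> letter list" where
  "column j y = map (\<lambda>i.
     if i = j then (if even j then Le else Lb)
     else if even i = (i < j) then (if y ! i then La else Ld)
     else (if y ! i then Lc else Lf)) [0..<length y]"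

lemma length_column [simp]: "length (column j y) = length y"
  by (simp add: column_def)

lemma nth_column:
  "i < length y \<Longrightarrow> column j y ! i =
    (if i = j then (if even j then Le else Lb)
     else if even i = (i < j) then (if y ! i then La else Ld)
     else (if y ! i then Lc else Lf))"
  by (simp add: column_def)

lemma column_alpha_word:
  assumes "odd (length y)" and "j < length y"
  shows "column j y \<in> alpha_words (length y)"
proof -
  have "length y > 0" "even (length y - 1)"
    using assms by auto
  moreover have "column j y ! 0 \<in> {La, Ld, Le}"
    using assms nth_column[of 0 y j] \<open>length y > 0\<close> by (cases "j = 0") auto
  moreover have "column j y ! (length y - 1) \<in> {Lc, Le, Lf}"
    using assms nth_column[of "length y - 1" y j] by (cases "j = length y - 1") auto
  moreover have "Down \<in> directions (column j y ! i) \<longleftrightarrow> Up \<in> directions (column j y ! (i + 1))"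
    if "i + 1 < length y" for i
    using that by (cases "j = i + 1") (auto simp: nth_column)
  ultimately show ?thesis
    by (simp add: alpha_words_def)
qed

text \<open>At \<open>j\<close> the letter is fixed by parity: \<open>Le\<close> has a right end and
  \<open>Lb\<close> has none. It fits the digit of \<open>y\<close> exactly at a position of
  agreement.\<close>

lemma outlet_column:
  assumes "j < length y" and "y ! j = even j"
  shows "outlet (column j y) = y"
  using assms by (intro nth_equalityI) (auto simp: outlet_def nth_column)

lemma column_left:
  assumes "i < length y" and "y ! j = even j"
  shows "Left \<in> directions (column j y ! i) \<longleftrightarrow> (if i = j then y ! i else \<not> y ! i)"
  using assms by (auto simp: nth_column)

text \<open>Both words agree with the alternating word at \<open>j\<close>, so
  \<open>column j\<close> yields an alpha-word for each. The left ends prescribed by the second word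
  spell out the first.\<close>

lemma flip_arc:
  assumes "odd m" and "S \<subseteq> {..<m}" and "j \<in> S"
  shows "(word_of m S, word_of m (insert j ({..<m} - S))) \<in> parcs (D_star m)"
proof -
  let ?x = "word_of m S" and ?y = "word_of m (insert j ({..<m} - S))"
  have j: "j < m"
    using assms by auto
  have "column j ?x \<in> alpha_words m" "column j ?y \<in> alpha_words m"
    using column_alpha_word[of ?x j] column_alpha_word[of ?y j] assms j by auto
  moreover have x: "outlet (column j ?x) = ?x" and "outlet (column j ?y) = ?y"
    using j assms by (auto intro!: outlet_column)
  moreover have "Right \<in> directions (column j ?x ! i) \<longleftrightarrow> Left \<in> directions (column j ?y ! i)"
    if "i < m" for i
  proof -
    have "Right \<in> directions (column j ?x ! i) \<longleftrightarrow> ?x ! i"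
      using arg_cong[OF x, of "\<lambda>z. z ! i"] that by (simp add: outlet_eq)
    moreover have "Left \<in> directions (column j ?y ! i) \<longleftrightarrow> (if i = j then ?y ! i else \<not> ?y ! i)"
      using that j assms by (intro column_left) auto
    ultimately show ?thesis
      using that assms by auto
  qed
  ultimately show ?thesis
    unfolding D_star_def D_graph_def by auto
qed

subsection \<open>The component of the zero word\<close>

lemma parcs_D_star_verts:
  "(x, y) \<in> parcs (D_star m) \<Longrightarrow> x \<in> pverts (D_star m) \<and> y \<in> pverts (D_star m)"
  by (auto simp: D_star_def)

lemma reachable_transitive:
  "x \<rightarrow>\<^sup>*\<^bsub>G\<^esub> y \<Longrightarrow> y \<rightarrow>\<^sup>*\<^bsub>G\<^esub> z \<Longrightarrow> x \<rightarrow>\<^sup>*\<^bsub>G\<^esub> z"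
  unfolding reachable_def by (rule rtrancl_on_trans)

lemma flip_reachable:
  fixes G and m :: nat
  defines "G \<equiv> with_proj (mk_symmetric (with_proj (D_star m)))"
  assumes "odd m" and "S \<subseteq> {..<m}" and "j \<in> S"
  shows "word_of m S \<rightarrow>\<^sup>*\<^bsub>G\<^esub> word_of m (insert j ({..<m} - S))"
    and "word_of m (insert j ({..<m} - S)) \<rightarrow>\<^sup>*\<^bsub>G\<^esub> word_of m S"
proof -
  let ?x = "word_of m S" and ?y = "word_of m (insert j ({..<m} - S))"
  have arc: "(?x, ?y) \<in> parcs (D_star m)"
    by (rule flip_arc) fact+
  then have "?x \<in> verts G" "?y \<in> verts G"
    using parcs_D_star_verts[OF arc] by (auto simp: G_def)
  moreover have "(?x, ?y) \<in> arcs_ends G" "(?y, ?x) \<in> arcs_ends G"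
    using bexI[OF _ arc] by (simp_all add: G_def parcs_mk_symmetric)
  ultimately show "?x \<rightarrow>\<^sup>*\<^bsub>G\<^esub> ?y" "?y \<rightarrow>\<^sup>*\<^bsub>G\<^esub> ?x"
    unfolding reachable_def by (simp_all add: rtrancl_on_into_rtrancl_on[OF rtrancl_on_refl])
qed

lemma exchange_reachable:
  fixes G and m :: nat
  defines "G \<equiv> with_proj (mk_symmetric (with_proj (D_star m)))"
  assumes "odd m" and "S \<subseteq> {..<m}" and "S' \<subseteq> {..<m}" and "card S = card S'" and "S \<noteq> {}"
  shows "word_of m S \<rightarrow>\<^sup>*\<^bsub>G\<^esub> word_of m S'"
  using assms(3-)
proof (induction "card (S - S')" arbitrary: S)
  case 0
  have "finite S" "finite S'"
    using 0 finite_subset by blast+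
  then have "S = S'"
    using 0 by (metis Diff_eq_empty_iff card_0_eq card_subset_eq finite_Diff)
  \<comment> \<open>\<open>reachable\<close> is reflexive only at vertices of the graph; a flip
    followed by its reverse supplies the walk from the word to itself.\<close>
  moreover obtain j where "j \<in> S"
    using 0 by auto
  ultimately show ?case
    using reachable_transitive[OF flip_reachable, of m S j] 0 \<open>odd m\<close>
    by (simp add: G_def)
next
  case (Suc n)
  have fin: "finite S" "finite S'"
    using Suc.prems finite_subset by blast+
  obtain j where j: "j \<in> S" "j \<notin> S'"
    using Suc.hyps(2) by (metis Diff_iff card.empty ex_in_conv nat.distinct(1))
  have "\<not> S' \<subseteq> S"
    using j fin Suc.prems by (metis card_subset_eq)
  then obtain j' where j': "j' \<in> S'" "j' \<notin> S"
    by auto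
  \<comment> \<open>The complement of \<open>T\<close> is \<open>S - {j}\<close>, so a flip at
    \<open>j'\<close> turns \<open>T\<close> into \<open>S\<close> with \<open>j\<close> exchanged
    for \<open>j'\<close>.\<close>
  define T where "T = insert j ({..<m} - S)"
  define U where "U = insert j' (S - {j})"
  have T: "T \<subseteq> {..<m}" "j' \<in> T"
    using j j' Suc.prems by (auto simp: T_def)
  have U: "U = insert j' ({..<m} - T)"
    using j j' Suc.prems by (auto simp: T_def U_def)
  have "card U = card S"
    using card_Suc_Diff1[OF fin(1) j(1)] j' fin by (simp add: U_def)
  moreover have "U - S' = (S - S') - {j}"
    using j' by (auto simp: U_def)
  then have "n = card (U - S')"
    using Suc.hyps(2) j fin by simp
  moreover have "U \<subseteq> {..<m}" "U \<noteq> {}"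
    using U T by auto
  ultimately have US: "word_of m U \<rightarrow>\<^sup>*\<^bsub>G\<^esub> word_of m S'"
    using Suc.hyps(1) Suc.prems by simp
  have ST: "word_of m S \<rightarrow>\<^sup>*\<^bsub>G\<^esub> word_of m T"
    unfolding G_def T_def using flip_reachable(1) \<open>odd m\<close> j Suc.prems by blast
  have TU: "word_of m T \<rightarrow>\<^sup>*\<^bsub>G\<^esub> word_of m U"
    unfolding G_def U using flip_reachable(1) \<open>odd m\<close> T by blast
  show ?case
    by (rule reachable_transitive[OF ST reachable_transitive[OF TU US]])
qed

lemma agreement_zero: "agreement (replicate m False) = {i. i < m \<and> odd i}"
  by (auto simp: agreement_def)

lemma card_odd_less: "card {i. i < 2 * k + 1 \<and> odd i} = k"
proof -
  have "{i. i < 2 * k + 1 \<and> odd i} = (\<lambda>i. 2 * i + 1) ` {..<k}"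
    by (auto elim!: oddE)
  then show ?thesis
    by (simp add: card_image inj_on_def)
qed

lemma pverts_R_star:
  assumes "m = 2 * k + 1" and "k > 0"
  shows "pverts (R_star m) = {x. length x = m \<and> card (agreement x) \<in> {k, k + 2}}"
proof -
  let ?G = "with_proj (mk_symmetric (with_proj (D_star m)))" and ?z = "replicate m False"
  have odd: "odd m"
    using assms by simp
  have z: "card (agreement ?z) = k" "length ?z = m"
    using card_odd_less[of k] unfolding agreement_zero assms(1) by simp_all
  have invariant: "length x = m \<and> card (agreement x) \<in> {k, k + 2}" if "?z \<rightarrow>\<^sup>*\<^bsub>?G\<^esub> x" for x
    using that unfolding reachable_def
  proof (induction rule: rtrancl_on_induct)
    case base
    then show ?case
      using z by simp
  next
    case (step x y)
    from step.hyps(2) have "(x, y) \<in> parcs (D_star m) \<or> (y, x) \<in> parcs (D_star m)"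
      by (auto simp: parcs_mk_symmetric)
    then have "length y = m" "card (agreement x) + card (agreement y) = m + 1"
      using arc_card_agreement[OF odd, of x y] arc_card_agreement[OF odd, of y x] by auto
    then show ?case
      using step.IH assms(1) by auto
  qed
  have lower: "?z \<rightarrow>\<^sup>*\<^bsub>?G\<^esub> word_of m S" if "S \<subseteq> {..<m}" "card S = k" for S
  proof -
    have "agreement ?z \<noteq> {}"
      using z(1) \<open>k > 0\<close> by auto
    then have "word_of m (agreement ?z) \<rightarrow>\<^sup>*\<^bsub>?G\<^esub> word_of m S"
      using z that agreement_subset[of ?z] by (intro exchange_reachable[OF odd]) auto
    then show ?thesis
      by simp
  qed
  \<comment> \<open>The complement of \<open>T\<close> has k - 1 elements, so a flip at any
    \<open>j\<close> in \<open>T\<close> leads to size k; this arc is then followed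
    backwards.\<close>
  have upper: "?z \<rightarrow>\<^sup>*\<^bsub>?G\<^esub> word_of m T" if T: "T \<subseteq> {..<m}" "card T = k + 2" for T
  proof -
    obtain j where j: "j \<in> T"
      using T by fastforce
    have "card (insert j ({..<m} - T)) = k"
      using j T assms by (simp add: card_Diff_subset finite_subset)
    moreover have "insert j ({..<m} - T) \<subseteq> {..<m}"
      using j T by auto
    ultimately have "?z \<rightarrow>\<^sup>*\<^bsub>?G\<^esub> word_of m (insert j ({..<m} - T))"
      using lower by simp
    then show ?thesis
      using flip_reachable(2)[OF odd T(1) j] by (rule reachable_transitive)
  qed
  have "?z \<rightarrow>\<^sup>*\<^bsub>?G\<^esub> x" if "length x = m" "card (agreement x) \<in> {k, k + 2}" for x
    using lower[of "agreement x"] upper[of "agreement x"] agreement_subset[of x] that by auto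
  with invariant have "{x. ?z \<rightarrow>\<^sup>*\<^bsub>?G\<^esub> x} = {x. length x = m \<and> card (agreement x) \<in> {k, k + 2}}"
    by blast
  then show ?thesis
    by (simp add: R_star_def component_of_def Let_def)
qed

subsection \<open>Reversal classes\<close>

text \<open>Fixed points form singleton classes, all other points two-element classes; doubling the
  number of classes counts each fixed point once more.\<close>

lemma card_involution_classes:
  assumes "finite V" and "\<And>x. x \<in> V \<Longrightarrow> f x \<in> V" and "\<And>x. f (f x) = x"
  shows "2 * card ((\<lambda>x. {x, f x}) ` V) = card V + card {x \<in> V. f x = x}"
proof -
  define F N where "F = {x \<in> V. f x = x}" and "N = {x \<in> V. f x \<noteq> x}"
  let ?c = "\<lambda>x. {x, f x}"
  have V: "V = F \<union> N" "F \<inter> N = {}" and fin: "finite F" "finite N"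
    using assms(1) by (auto simp: F_def N_def)
  have "\<Union> (?c ` N) = N"
    using assms(2,3) by (auto simp: N_def)
  moreover have "2 * card (?c ` N) = card (\<Union> (?c ` N))"
  proof (rule card_partition)
    show "A \<inter> B = {}" if "A \<in> ?c ` N" "B \<in> ?c ` N" "A \<noteq> B" for A B
      using that assms(3) by auto metis+
  qed (use fin in \<open>auto simp: N_def card_insert_if\<close>)
  moreover have "card (?c ` F) = card F"
    by (rule card_image) (auto simp: inj_on_def F_def)
  moreover have "?c ` F \<inter> ?c ` N = {}"
    by (auto simp: F_def N_def)
  ultimately show ?thesis
    using fin unfolding F_def[symmetric]
    by (simp add: V image_Un card_Un_disjoint)
qed

text \<open>For odd length n the reflection taking i to n - 1 - i preserves parity.\<close>

lemma card_agreement_rev: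
  assumes "odd (length x)"
  shows "card (agreement (rev x)) = card (agreement x)"
proof -
  have "bij_betw (\<lambda>i. length x - 1 - i) (agreement (rev x)) (agreement x)"
    using assms by (intro bij_betwI[where g = "\<lambda>i. length x - 1 - i"])
      (auto simp: agreement_def rev_nth)
  then show ?thesis
    by (rule bij_betw_same_card)
qed

lemma card_agreement_palindrome:
  "card (agreement (w @ [c] @ rev w)) =
    2 * card (agreement w) + of_bool (c = even (length w))"
proof -
  let ?k = "length w" and ?x = "w @ [c] @ rev w"
  let ?g = "\<lambda>i. of_bool (?x ! i = even i) :: nat"
  have split: "(\<Sum>i<a + b. g i) = (\<Sum>i<a. g i) + (\<Sum>i<b. g (a + i))"
    for a b and g :: "nat \<Rightarrow> nat"
    by (induction b) (auto simp: add.assoc)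
  have "card (agreement ?x) = (\<Sum>i<Suc ?k + ?k. ?g i)"
    by (simp add: card_agreement)
  also have "\<dots> = (\<Sum>i<?k. ?g i) + ?g ?k + (\<Sum>i<?k. ?g (Suc ?k + i))"
    by (simp only: split sum.lessThan_Suc)
  also have "(\<Sum>i<?k. ?g i) = card (agreement w)"
    unfolding card_agreement by (intro sum.cong) (auto simp: nth_append)
  \<comment> \<open>The mirrored indices k + 1 + i and k - 1 - i add up to 2k and so have equal
    parity.\<close>
  also have "(\<Sum>i<?k. ?g (Suc ?k + i)) = (\<Sum>i<?k. of_bool (w ! (?k - Suc i) = even (?k - Suc i)))"
    by (intro sum.cong) (auto simp: nth_append rev_nth)
  also have "\<dots> = card (agreement w)"
    unfolding card_agreement by (rule sum.nat_diff_reindex)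
  finally show ?thesis
    by (simp add: nth_append)
qed

lemma card_palindromes:
  assumes "m = 2 * k + 1"
  shows "card {x. (length x = m \<and> card (agreement x) \<in> {k, k + 2}) \<and> rev x = x} =
    Suc k choose Suc (k div 2)"
proof -
  let ?W = "{w. length w = k \<and> card (agreement w) \<in> {k div 2, Suc (k div 2)}}"
  have "{x. (length x = m \<and> card (agreement x) \<in> {k, k + 2}) \<and> rev x = x} =
      (\<lambda>w. w @ [False] @ rev w) ` ?W" (is "?P = ?f ` ?W")
  proof (intro equalityI subsetI)
    fix x assume x: "x \<in> ?P"
    define w c where "w = take k x" and "c = x ! k"
    have "x = w @ [c] @ drop (Suc k) x" and lw: "length w = k"
      using x assms by (auto simp: w_def c_def id_take_nth_drop)
    moreover have "drop (Suc k) x = rev w"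
      using x assms rev_take[of k x] by (auto simp: w_def)
    ultimately have xw: "x = w @ [c] @ rev w"
      by simp
    then have "2 * card (agreement w) + of_bool (c = even k) \<in> {k, k + 2}"
      using x card_agreement_palindrome[of w c] lw by auto
    \<comment> \<open>Since k and k + 2 have the parity of k, the indicator is 0 for even k and 1
      for odd k; either way the middle digit \<open>c\<close> is 0.\<close>
    then have "\<not> c \<and> card (agreement w) \<in> {k div 2, Suc (k div 2)}"
      by (cases c; cases "even k") (auto; presburger)+
    then show "x \<in> ?f ` ?W"
      using xw lw by auto
  next
    fix x assume "x \<in> ?f ` ?W"
    then obtain w where "x = w @ [False] @ rev w" "w \<in> ?W"
      by blast
    then show "x \<in> ?P"
      using card_agreement_palindrome[of w False] assms by auto
  qed
  moreover have "inj_on ?f ?W"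
    by (auto simp: inj_on_def)
  ultimately show ?thesis
    \<comment> \<open>The two possible sizes for the first half are consecutive, so Pascal's rule
      merges their binomial coefficients.\<close>
    by (simp add: card_image card_words_agreement2[of "k div 2" "Suc (k div 2)", simplified])
qed

theorem mainTheorem1:
  fixes m :: nat
  assumes "m \<ge> 3" and "odd m"
  shows "card (pverts (R_star m)) = (m + 1) choose ((m - 1) div 2) \<and>
    real (card (verts (R_star_star m))) =
      1 / 2 * (real ((m + 1) choose ((m - 1) div 2)) +
               real (((m + 1) div 2) choose ((m + 1) div 4)))"
proof -
  obtain k where m: "m = 2 * k + 1"
    using \<open>odd m\<close> by (rule oddE)
  with \<open>m \<ge> 3\<close> have k: "k > 0"
    by simp
  let ?V = "{x. length x = m \<and> card (agreement x) \<in> {k, k + 2}}"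
  have V: "pverts (R_star m) = ?V"
    by (rule pverts_R_star[OF m k])
  \<comment> \<open>Symmetry makes the two lower indices consecutive, ready for Pascal's
    rule.\<close>
  have "m choose (k + 2) = m choose (k - 1)"
    using m k binomial_symmetric[of "k + 2" m] by (simp add: numeral_2_eq_2)
  then have "card ?V = (m choose k) + (m choose (k - 1))"
    by (subst card_words_agreement2) auto
  then have count: "card ?V = (m + 1) choose k"
    using k by (cases k) auto
  have "card {x \<in> ?V. rev x = x} = Suc k choose Suc (k div 2)"
    using card_palindromes[OF m] by simp
  \<comment> \<open>For odd k the lower indices coincide; for even k they add up to k + 1, and
    symmetry applies.\<close>
  also have "\<dots> = Suc k choose (Suc k div 2)"
  proof (cases "even k")
    case True
    then have "Suc k - Suc (k div 2) = Suc k div 2"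
      by presburger
    then show ?thesis
      using binomial_symmetric[of "Suc (k div 2)" "Suc k"] by simp
  next
    case False
    then have "Suc k div 2 = Suc (k div 2)"
      by presburger
    then show ?thesis
      by simp
  qed
  finally have palindromes: "card {x \<in> ?V. rev x = x} = Suc k choose (Suc k div 2)" .
  have "2 * card ((\<lambda>x. {x, rev x}) ` ?V) = card ?V + card {x \<in> ?V. rev x = x}"
    by (rule card_involution_classes)
      (use finite_words_agreement card_agreement_rev \<open>odd m\<close> in auto)
  moreover have "verts (R_star_star m) = (\<lambda>x. {x, rev x}) ` ?V"
    unfolding R_star_star_def V rev_class_def by simp
  ultimately have "2 * card (verts (R_star_star m)) =
      ((m + 1) choose k) + (Suc k choose (Suc k div 2))"
    using count palindromes by simp
  moreover have "(m + 1) div 2 = Suc k" "(m + 1) div 4 = Suc k div 2" "(m - 1) div 2 = k"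
    using m by auto
  ultimately show ?thesis
    using V count by (simp flip: of_nat_add)
qed

end
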